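(* Let $w^\star=(x^\star,y^\star)\in W^\star$. Assume that there exist an affine set $\mathcal F\subset\mathbb R^n$ with $x^\star\in\mathcal F$, a neighborhood $U_x$ of $x^\star$, a symmetric matrix $H_{\mathcal F}\succeq0$ and a vector $c_{\mathcal F}\in\mathbb R^n$ such that, with $\mathcal L_{\mathcal F}:=\operatorname{span}(\mathcal F-\mathcal F)$, $$\partial g(x)=H_{\mathcal F}x+c_{\mathcal F}+\mathcal L_{\mathcal F}^\perp\qquad\forall x\in\mathcal F\cap U_x .$$ Let $\Pi_{\mathcal F}$ be the orthogonal projector of $\mathbb R^n$ onto $\mathcal L_{\mathcal F}$ and, for $(u,y)\in\mathcal L_{\mathcal F}\times\mathbb R^m$, set $\Psi(u,y):=(x^\star+u,y)$ and $$\mathcal T_{\rm red}(u,y):=\begin{pmatrix} \Pi_{\mathcal F}\bigl(\nabla f(x^\star+u)+H_{\mathcal F}(x^\star+u)+c_{\mathcal F}-A^\top y+\sigma A^\top Au\bigr) \\ Au \end{pmatrix}.$$ Then there exists a neighborhood $U_{\rm red}$ of $z^\star:=(0,y^\star)$ in $\mathcal L_{\mathcal F}\times\mathbb R^m$ such that, for every $z\in U_{\rm red}$, $$\operatorname{dist}\bigl(0,\mathcal T(\Psi(z))\bigr)=\|\mathcal T_{\rm red}(z)\|.$$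
   Context: Setting: $A\in\mathbb R^{m\times n}$, $b\in\mathbb R^m$, $\sigma\ge0$; $f:\mathbb R^n\to\mathbb R$ is convex and continuously differentiable with Lipschitz continuous gradient; $g:\mathbb R^n\to(-\infty,+\infty]$ is proper, closed and convex. The set-valued augmented KKT operator is $$\mathcal T(x,y)=\begin{pmatrix} \nabla f(x)+\partial g(x)-A^\top y+\sigma A^\top(Ax-b) \\ Ax-b \end{pmatrix},\qquad W^\star:=\mathcal T^{-1}(0).$$ Norms and distances are Euclidean. *)

theory Defs
  imports "HOL-Analysis.Analysis"
begin

definition gradient :: "('a::euclidean_space \<Rightarrow> real) \<Rightarrow> 'a \<Rightarrow> 'a" where
  "gradient f x = (THE D. GDERIV f x :> D)"

(* The library's epigraph is restricted to real-valued functions. *)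
definition ext_epigraph :: "('a \<Rightarrow> ereal) \<Rightarrow> ('a \<times> real) set" where
  "ext_epigraph g = {(x, r). g x \<le> ereal r}"

definition proper_fun :: "('a \<Rightarrow> ereal) \<Rightarrow> bool" where
  "proper_fun g \<longleftrightarrow> (\<forall>x. g x \<noteq> -\<infinity>) \<and> (\<exists>x. g x \<noteq> \<infinity>)"

definition closed_fun :: "('a::topological_space \<Rightarrow> ereal) \<Rightarrow> bool" where
  "closed_fun g \<longleftrightarrow> closed (ext_epigraph g)"

definition convex_fun :: "('a::real_vector \<Rightarrow> ereal) \<Rightarrow> bool" where
  "convex_fun g \<longleftrightarrow> convex (ext_epigraph g)"

(* Empty outside the effective domain of g. *)
definition subdifferential :: "('a::real_inner \<Rightarrow> ereal) \<Rightarrow> 'a \<Rightarrow> 'a set" where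
  "subdifferential g x =
     {v. \<bar>g x\<bar> \<noteq> \<infinity> \<and> (\<forall>z. g x + ereal (v \<bullet> (z - x)) \<le> g z)}"

(* Unlike infdist, which is 0 on the empty set, this is infinite there. *)
definition ext_infdist :: "'a::metric_space \<Rightarrow> 'a set \<Rightarrow> ereal" where
  "ext_infdist p S = (INF v\<in>S. ereal (dist p v))"

definition orth_projector :: "'a::euclidean_space set \<Rightarrow> 'a \<Rightarrow> 'a" where
  "orth_projector L x = (THE p. p \<in> L \<and> x - p \<in> orthogonal_comp L)"

definition direction_space :: "'a::real_vector set \<Rightarrow> 'a set" where
  "direction_space F = span {p - q | p q. p \<in> F \<and> q \<in> F}"

definition psd :: "real^'n^'n \<Rightarrow> bool" where
  "psd H \<longleftrightarrow> transpose H = H \<and> (\<forall>v. 0 \<le> v \<bullet> (H *v v))"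

definition kkt_op ::
  "(real^'n \<Rightarrow> real) \<Rightarrow> (real^'n \<Rightarrow> ereal) \<Rightarrow> real^'n^'m \<Rightarrow> real^'m \<Rightarrow> real
    \<Rightarrow> (real^'n) \<times> (real^'m) \<Rightarrow> ((real^'n) \<times> (real^'m)) set" where
  "kkt_op f g A b \<sigma> = (\<lambda>(x, y).
     {(gradient f x + v - transpose A *v y + \<sigma> *\<^sub>R (transpose A *v (A *v x - b)),
       A *v x - b) | v. v \<in> subdifferential g x})"

definition kkt_sol ::
  "(real^'n \<Rightarrow> real) \<Rightarrow> (real^'n \<Rightarrow> ereal) \<Rightarrow> real^'n^'m \<Rightarrow> real^'m \<Rightarrow> real
    \<Rightarrow> ((real^'n) \<times> (real^'m)) set" where
  "kkt_sol f g A b \<sigma> = {w. 0 \<in> kkt_op f g A b \<sigma> w}"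

(* The maps lift and kkt_red are only meant for u in direction_space F; they are
   total functions on the ambient space. *)
definition lift :: "real^'n \<Rightarrow> (real^'n) \<times> (real^'m) \<Rightarrow> (real^'n) \<times> (real^'m)" where
  "lift xs = (\<lambda>(u, y). (xs + u, y))"

definition kkt_red ::
  "(real^'n \<Rightarrow> real) \<Rightarrow> real^'n^'m \<Rightarrow> real \<Rightarrow> (real^'n) set \<Rightarrow> real^'n^'n \<Rightarrow> real^'n
    \<Rightarrow> real^'n \<Rightarrow> (real^'n) \<times> (real^'m) \<Rightarrow> (real^'n) \<times> (real^'m)" where
  "kkt_red f A \<sigma> F H c xs = (\<lambda>(u, y).
     (orth_projector (direction_space F)
        (gradient f (xs + u) + H *v (xs + u) + c - transpose A *v y
          + \<sigma> *\<^sub>R (transpose A *v (A *v u))),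
      A *v u))"

end

theory Submission
  imports Defs
begin

text \<open>Both operators share the second component \<open>A u\<close>, and near \<open>xs\<close> the first component of
  the full operator runs over a coset \<open>r + L\<^sup>\<bottom>\<close>, whose element of least norm is the projection
  of \<open>r\<close> onto \<open>L\<close>, i.e. the first component of the reduced operator.\<close>

text \<open>Makes the description by \<open>THE\<close> usable. Existence is the orthogonal
  decomposition along \<open>L\<close>; two candidates differ by a vector lying in both
  \<open>L\<close> and its orthogonal complement, hence orthogonal to itself.\<close>

lemma orth_projector_props:
  assumes "subspace L"
  shows "orth_projector L x \<in> L" "x - orth_projector L x \<in> orthogonal_comp L"
proof -
  have ex: "\<exists>p. p \<in> L \<and> x - p \<in> orthogonal_comp L"
  proof -
    have "span L = L"
      using assms by (simp add: span_eq_iff)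
    then obtain p q where "p \<in> L" "\<And>w. w \<in> L \<Longrightarrow> orthogonal q w" "x = p + q"
      using orthogonal_subspace_decomp_exists[of L x] by metis
    then show ?thesis
      by (intro exI[of _ p]) (simp add: orthogonal_comp_def orthogonal_commute)
  qed
  have uniq: "p = q"
    if "p \<in> L \<and> x - p \<in> orthogonal_comp L" "q \<in> L \<and> x - q \<in> orthogonal_comp L" for p q
  proof -
    have "p - q \<in> L"
      using that assms by (simp add: subspace_diff)
    moreover have "p - q \<in> orthogonal_comp L"
      using subspace_diff[OF subspace_orthogonal_comp, of "x - q" L "x - p"] that by simp
    ultimately have "orthogonal (p - q) (p - q)"
      by (simp add: orthogonal_comp_def)
    then show ?thesis by (simp add: orthogonal_def)
  qed
  have "orth_projector L x \<in> L \<and> x - orth_projector L x \<in> orthogonal_comp L"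
    unfolding orth_projector_def by (rule theI') (use ex uniq in blast)
  then show "orth_projector L x \<in> L" "x - orth_projector L x \<in> orthogonal_comp L"
    by auto
qed

text \<open>With \<open>p\<close> the projection of \<open>x\<close>, split \<open>x + v\<close> as
  \<open>p + (x - p + v)\<close>. The second summand is orthogonal to \<open>L\<close>, so
  Pythagoras applies.\<close>

lemma norm_orth_projector_le:
  assumes L: "subspace L" and v: "v \<in> orthogonal_comp L"
  shows "norm (orth_projector L x) \<le> norm (x + v)"
proof -
  let ?p = "orth_projector L x"
  have "x - ?p + v \<in> orthogonal_comp L"
    using orth_projector_props(2)[OF L] v by (simp add: subspace_add subspace_orthogonal_comp)
  then have "orthogonal ?p (x - ?p + v)"
    using orth_projector_props(1)[OF L] by (simp add: orthogonal_comp_def)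
  from norm_add_Pythagorean[OF this] have "(norm ?p)\<^sup>2 \<le> (norm (x + v))\<^sup>2"
    by (simp add: algebra_simps)
  then show ?thesis
    by (rule power2_le_imp_le) simp
qed

lemma ext_infdist_coset_orthogonal_comp:
  assumes L: "subspace L"
  shows "ext_infdist 0 {(r + v, s) | v. v \<in> orthogonal_comp L} = ereal (norm (orth_projector L r, s))"
  unfolding ext_infdist_def
proof (rule antisym)
  let ?S = "{(r + v, s) | v. v \<in> orthogonal_comp L}"
  \<comment> \<open>The infimum is attained: this choice of \<open>v\<close> moves \<open>r\<close>
    exactly to its projection.\<close>
  have "orth_projector L r - r \<in> orthogonal_comp L"
    using orth_projector_props(2)[OF L, of r] subspace_neg[OF subspace_orthogonal_comp] by fastforce
  then have "(orth_projector L r, s) \<in> ?S"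
    by (intro CollectI exI[of _ "orth_projector L r - r"]) simp
  then show "(INF v\<in>?S. ereal (dist 0 v)) \<le> ereal (norm (orth_projector L r, s))"
    by (rule INF_lower2) simp
  show "ereal (norm (orth_projector L r, s)) \<le> (INF v\<in>?S. ereal (dist 0 v))"
  proof (rule INF_greatest)
    fix w assume "w \<in> ?S"
    then obtain v where w: "w = (r + v, s)" and v: "v \<in> orthogonal_comp L" by blast
    \<comment> \<open>Squares, because the norm of a pair is the root of the sum of squares and both
      pairs share the component \<open>s\<close>.\<close>
    have "(norm (orth_projector L r))\<^sup>2 \<le> (norm (r + v))\<^sup>2"
      by (rule power_mono[OF norm_orth_projector_le[OF L v] norm_ge_zero])
    then show "ereal (norm (orth_projector L r, s)) \<le> ereal (dist 0 w)"
      by (simp add: w norm_Pair)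
  qed
qed

text \<open>The translate of \<open>F\<close> by \<open>- a\<close> is a subspace containing every
  difference of points of \<open>F\<close>, hence also their span.\<close>

lemma affine_add_direction_space:
  assumes F: "affine F" and a: "a \<in> F" and u: "u \<in> direction_space F"
  shows "a + u \<in> F"
proof -
  let ?V = "(\<lambda>x. - a + x) ` F"
  have V: "subspace ?V"
    using affine_diffs_subspace[OF F a] .
  have "p - q \<in> ?V" if "p \<in> F" "q \<in> F" for p q
    using subspace_diff[OF V imageI[OF that(1)] imageI[OF that(2)]] by simp
  then have "direction_space F \<subseteq> ?V"
    unfolding direction_space_def by (intro span_minimal V) auto
  with u show ?thesis by auto
qed

theorem theorem5:
  fixes A :: "real^'n^'m" and b :: "real^'m" and \<sigma> :: real
    and f :: "real^'n \<Rightarrow> real" and g :: "real^'n \<Rightarrow> ereal"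
    and xs :: "real^'n" and ys :: "real^'m"
    and F U\<^sub>x :: "(real^'n) set" and H :: "real^'n^'n" and c :: "real^'n"
  assumes "0 \<le> \<sigma>"
    and "convex_on UNIV f"
    and "\<And>x. f differentiable (at x)"
    and "continuous_on UNIV (gradient f)"
    and "\<exists>C. C-lipschitz_on UNIV (gradient f)"
    and "proper_fun g" and "closed_fun g" and "convex_fun g"
    and "(xs, ys) \<in> kkt_sol f g A b \<sigma>"
    and "affine F" and "xs \<in> F"
    and "xs \<in> interior U\<^sub>x"
    and "psd H"
    and "\<And>x. x \<in> F \<inter> U\<^sub>x \<Longrightarrow>
           subdifferential g x = {H *v x + c + v | v. v \<in> orthogonal_comp (direction_space F)}"
  shows "\<exists>U. openin (top_of_set (direction_space F \<times> (UNIV :: (real^'m) set))) U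
           \<and> (0, ys) \<in> U
           \<and> (\<forall>z\<in>U. ext_infdist 0 (kkt_op f g A b \<sigma> (lift xs z))
                      = ereal (norm (kkt_red f A \<sigma> F H c xs z)))"
proof -
  let ?L = "direction_space F"
  have L: "subspace ?L"
    by (simp add: direction_space_def)
  \<comment> \<open>Feasibility of \<open>xs\<close>, read off the second component of the KKT
    inclusion.\<close>
  have b: "A *v xs = b"
    using assms(9) by (auto simp: kkt_sol_def kkt_op_def zero_prod_def)
  \<comment> \<open>The factor \<open>?L\<close> keeps \<open>xs + u\<close> in \<open>F\<close>;
    taking the interior of the neighborhood makes \<open>U\<close> relatively open.\<close>
  define U :: "((real^'n) \<times> (real^'m)) set"
    where "U = (?L \<times> UNIV) \<inter> (\<lambda>z. xs + fst z) -` interior U\<^sub>x"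
  have "open ((\<lambda>z::(real^'n) \<times> (real^'m). xs + fst z) -` interior U\<^sub>x)"
    by (intro open_vimage open_interior continuous_intros)
  then have "openin (top_of_set (?L \<times> UNIV)) U"
    unfolding U_def by (rule openin_open_Int)
  moreover have "(0, ys) \<in> U"
    using assms(12) subspace_0[OF L] by (simp add: U_def)
  moreover have "ext_infdist 0 (kkt_op f g A b \<sigma> (lift xs z)) = ereal (norm (kkt_red f A \<sigma> F H c xs z))"
    if "z \<in> U" for z
  proof -
    obtain u y where z: "z = (u, y)" by fastforce
    have u: "u \<in> ?L" and "xs + u \<in> U\<^sub>x"
      using that interior_subset by (auto simp: U_def z)
    then have subdiff: "subdifferential g (xs + u) = {H *v (xs + u) + c + v | v. v \<in> orthogonal_comp ?L}"
      by (intro assms(14)) (simp add: affine_add_direction_space[OF assms(10,11)])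
    \<comment> \<open>Feasibility turns the residual at \<open>xs + u\<close> into
      \<open>A *v u\<close>, both in the second component and in the \<sigma> term.\<close>
    have Au: "A *v (xs + u) - b = A *v u"
      by (simp add: b matrix_vector_right_distrib)
    let ?r = "gradient f (xs + u) + H *v (xs + u) + c - transpose A *v y
                + \<sigma> *\<^sub>R (transpose A *v (A *v u))"
    \<comment> \<open>Isolates \<open>v\<close>, so that the values of the full operator take the
      coset form of \<open>ext_infdist_coset_orthogonal_comp\<close>, with \<open>?r\<close> the
      vector projected in \<open>kkt_red\<close>.\<close>
    have reorder: "gradient f (xs + u) + (H *v (xs + u) + c + v) - transpose A *v y
        + \<sigma> *\<^sub>R (transpose A *v (A *v u)) = ?r + v" for v
      by simp
    have "kkt_op f g A b \<sigma> (lift xs z) =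
        {(gradient f (xs + u) + (H *v (xs + u) + c + v) - transpose A *v y
          + \<sigma> *\<^sub>R (transpose A *v (A *v u)), A *v u) | v. v \<in> orthogonal_comp ?L}"
      unfolding z lift_def kkt_op_def prod.case subdiff Au by blast
    then show ?thesis
      unfolding reorder by (simp only: ext_infdist_coset_orthogonal_comp[OF L] z kkt_red_def prod.case)
  qed
  ultimately show ?thesis by blast
qed

end
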